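(* There exists an infinite family of transitive Boolean functions $F_i:\{0,1\}^{N_i}\to\{0,1\}$ ($i\in\mathbb{N}$), with $N_i\to\infty$ and $D(F_i)\to\infty$, such that $$D(F_i)=\widetilde{\Omega}\big(s(F_i)^3\big).$$
   Context: A subgroup $G\le S_N$ is transitive if for all $i,j\in[N]$ there is $\sigma\in G$ with $\sigma(i)=j$. A function $f:\{0,1\}^N\to\{0,1\}$ is transitive if there is a transitive group $G\le S_N$ such that $f(x_1,\dots,x_N)=f(x_{\sigma(1)},\dots,x_{\sigma(N)})$ for all $x\in\{0,1\}^N$ and all $\sigma\in G$. For total $f:\{0,1\}^N\to\{0,1\}$: - $D(f)$, deterministic query complexity, is the worst-case number of queried input bits of the best deterministic query algorithm (decision tree) computing $f$. - $s(f)=\max_{x}|\{i\in[N]: f(x)\ne f(x^{i})\}|$, the sensitivity, where $x^{i}$ is $x$ with bit $i$ flipped. Notation: for quantities $A_i,B_i$ attached to $F_i$, $A_i=\widetilde{\Omega}(B_i)$ means that there are constants $c>0$ and $C\ge 0$ with $A_i\ge c\,B_i/(\log N_i)^C$ for all sufficiently large $i$. *)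

theory Defs
  imports Complex_Main "HOL-Algebra.Sym_Groups"
begin

text \<open>
  The cube \<open>{0,1}^N\<close> is modelled by the extensional Boolean functions on \<open>{1..N}\<close>. A function
  \<open>f : {0,1}^N \<rightarrow> {0,1}\<close> is a HOL function of which only the values on \<open>cube N\<close> are
  ever used; its values elsewhere are irrelevant.
\<close>

definition cube :: "nat \<Rightarrow> (nat \<Rightarrow> bool) set" where
  "cube N = {1..N} \<rightarrow>\<^sub>E (UNIV :: bool set)"

definition flip_bit :: "nat \<Rightarrow> (nat \<Rightarrow> bool) \<Rightarrow> (nat \<Rightarrow> bool)" where
  "flip_bit i x = x(i := \<not> x i)"

definition transitive_perm_group :: "nat \<Rightarrow> (nat \<Rightarrow> nat) set \<Rightarrow> bool" where
  "transitive_perm_group N G \<longleftrightarrow>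
     subgroup G (sym_group N) \<and> (\<forall>i\<in>{1..N}. \<forall>j\<in>{1..N}. \<exists>\<sigma>\<in>G. \<sigma> i = j)"

text \<open>
  The tuple \<open>(x_{\<sigma>(1)}, \<dots>, x_{\<sigma>(N)})\<close> is \<open>x \<circ> \<sigma>\<close>; it lies in \<open>cube N\<close> again because
  \<open>\<sigma>\<close> fixes everything outside \<open>{1..N}\<close>.
\<close>

definition transitive_function :: "nat \<Rightarrow> ((nat \<Rightarrow> bool) \<Rightarrow> bool) \<Rightarrow> bool" where
  "transitive_function N f \<longleftrightarrow>
     (\<exists>G. transitive_perm_group N G \<and> (\<forall>x\<in>cube N. \<forall>\<sigma>\<in>G. f x = f (x \<circ> \<sigma>)))"

definition sensitivity :: "nat \<Rightarrow> ((nat \<Rightarrow> bool) \<Rightarrow> bool) \<Rightarrow> nat" where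
  "sensitivity N f = (MAX x\<in>cube N. card {i \<in> {1..N}. f x \<noteq> f (flip_bit i x)})"

text \<open>\<open>Query i t0 t1\<close> reads bit \<open>i\<close> and continues with \<open>t0\<close> if it is 0 and with \<open>t1\<close> if it is 1.\<close>

datatype decision_tree = Answer bool | Query nat decision_tree decision_tree

primrec dt_output :: "decision_tree \<Rightarrow> (nat \<Rightarrow> bool) \<Rightarrow> bool" where
  "dt_output (Answer b) x = b"
| "dt_output (Query i t0 t1) x = (if x i then dt_output t1 x else dt_output t0 x)"

primrec num_queries :: "decision_tree \<Rightarrow> (nat \<Rightarrow> bool) \<Rightarrow> nat" where
  "num_queries (Answer b) x = 0"
| "num_queries (Query i t0 t1) x = Suc (if x i then num_queries t1 x else num_queries t0 x)"

primrec queried_vars :: "decision_tree \<Rightarrow> nat set" where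
  "queried_vars (Answer b) = {}"
| "queried_vars (Query i t0 t1) = insert i (queried_vars t0 \<union> queried_vars t1)"

definition computes :: "nat \<Rightarrow> decision_tree \<Rightarrow> ((nat \<Rightarrow> bool) \<Rightarrow> bool) \<Rightarrow> bool" where
  "computes N t f \<longleftrightarrow> queried_vars t \<subseteq> {1..N} \<and> (\<forall>x\<in>cube N. dt_output t x = f x)"

definition worst_case_queries :: "nat \<Rightarrow> decision_tree \<Rightarrow> nat" where
  "worst_case_queries N t = (MAX x\<in>cube N. num_queries t x)"

definition query_complexity :: "nat \<Rightarrow> ((nat \<Rightarrow> bool) \<Rightarrow> bool) \<Rightarrow> nat" where
  "query_complexity N f = (LEAST d. \<exists>t. computes N t f \<and> worst_case_queries N t = d)"

text \<open>
  The relation \<open>A_i = \<Omega>~(B_i)\<close> with respect to the sizes \<open>N_i\<close>. The base of the logarithm is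
  immaterial, since changing it only changes the constant \<open>c\<close>.
\<close>

definition soft_Omega :: "(nat \<Rightarrow> nat) \<Rightarrow> (nat \<Rightarrow> real) \<Rightarrow> (nat \<Rightarrow> real) \<Rightarrow> bool" where
  "soft_Omega N A B \<longleftrightarrow>
     (\<exists>c>0. \<exists>C\<ge>0. \<forall>\<^sub>F i in sequentially. A i \<ge> c * B i / ln (real (N i)) powr C)"

text \<open>The maxima and the minimum above range over nonempty sets.\<close>

lemma finite_cube: "finite (cube N)"
  unfolding cube_def by (intro finite_PiE) auto

lemma cube_nonempty: "cube N \<noteq> {}"
  unfolding cube_def by (simp add: PiE_eq_empty_iff)

lemma flip_bit_in_cube: "x \<in> cube N \<Longrightarrow> i \<in> {1..N} \<Longrightarrow> flip_bit i x \<in> cube N"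
  unfolding cube_def flip_bit_def by (auto simp: PiE_iff extensional_def)

lemma permuted_in_cube:
  assumes "x \<in> cube N" "\<sigma> \<in> carrier (sym_group N)"
  shows "x \<circ> \<sigma> \<in> cube N"
  using assms unfolding cube_def sym_group_carrier
  by (auto simp: PiE_iff extensional_def permutes_def)

lemma ex_computes: "\<exists>t. computes N t f"
proof -
  have *: "\<exists>t. queried_vars t \<subseteq> {1..N} \<and> (\<forall>x\<in>cube N. dt_output t x = g x)"
    if "finite S" "S \<subseteq> {1..N}" "\<And>x y. x \<in> cube N \<Longrightarrow> y \<in> cube N \<Longrightarrow> (\<And>i. i \<in> S \<Longrightarrow> x i = y i) \<Longrightarrow> g x = g y"
    for S and g :: "(nat \<Rightarrow> bool) \<Rightarrow> bool"
    using that
  proof (induction S arbitrary: g rule: finite_induct)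
    case empty
    obtain z where "z \<in> cube N" using cube_nonempty by blast
    then have "\<forall>x\<in>cube N. dt_output (Answer (g z)) x = g x"
      using empty.prems(2)[of z] by simp
    then show ?case by (intro exI[of _ "Answer (g z)"]) simp
  next
    case (insert a S)
    have upd: "x(a := b) \<in> cube N" if "x \<in> cube N" for x b
      using that insert.prems(1) unfolding cube_def by (auto simp: PiE_iff extensional_def)
    have "\<exists>t. queried_vars t \<subseteq> {1..N} \<and> (\<forall>x\<in>cube N. dt_output t x = g (x(a := b)))" for b
    proof (rule insert.IH)
      show "S \<subseteq> {1..N}" using insert.prems(1) by simp
      fix x y
      assume x: "x \<in> cube N" and y: "y \<in> cube N" and eq: "\<And>i. i \<in> S \<Longrightarrow> x i = y i"
      show "g (x(a := b)) = g (y(a := b))"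
      proof (rule insert.prems(2)[OF upd[OF x] upd[OF y]])
        show "(x(a := b)) i = (y(a := b)) i" if "i \<in> insert a S" for i
          using that eq by (cases "i = a") simp_all
      qed
    qed
    then have "\<exists>T. \<forall>b. queried_vars (T b) \<subseteq> {1..N} \<and>
        (\<forall>x\<in>cube N. dt_output (T b) x = g (x(a := b)))"
      by (intro choice) blast
    then obtain T where T: "\<And>b. queried_vars (T b) \<subseteq> {1..N}"
      "\<And>b x. x \<in> cube N \<Longrightarrow> dt_output (T b) x = g (x(a := b))"
      by blast
    have "dt_output (Query a (T False) (T True)) x = g x" if "x \<in> cube N" for x
    proof -
      have "dt_output (Query a (T False) (T True)) x = dt_output (T (x a)) x"
        by (cases "x a") simp_all
      also have "\<dots> = g x"
        using T(2)[OF that, of "x a"] by (simp only: fun_upd_triv)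
      finally show ?thesis .
    qed
    then show ?case
      using T(1) insert.prems(1) by (intro exI[of _ "Query a (T False) (T True)"]) simp
  qed
  have "f x = f y" if "x \<in> cube N" "y \<in> cube N" "\<And>i. i \<in> {1..N} \<Longrightarrow> x i = y i" for x y
  proof -
    have "x = y"
      using that(1,2) unfolding cube_def by (rule PiE_ext) (use that(3) in simp)
    then show ?thesis by simp
  qed
  then show ?thesis
    unfolding computes_def using *[of "{1..N}" f] by blast
qed

end

theory Submission
  imports Defs
begin

text \<open>A pointer function in the style of Goeoes, Pitassi and Watson. The input is a cyclic array of
  \<open>n^3\<close> cells, divided into \<open>n\<close> blocks (residues modulo \<open>n\<close>) of \<open>n\<close> columns (residues modulo \<open>n^2\<close>)
  of \<open>n\<close> cells. Its value is 1 iff some block has a column in which a single cell is not inert, and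
  the chain of pointers from this cell runs through all columns of the block. A certificate reads
  \<open>O(n)\<close> cells, and a block has at most one certificate. An adversary that lets only the last cell of
  each column be a pointer, to the column completed before, keeps the value open until all \<open>n^3\<close> cells
  are read.

  Each cell is encoded by \<open>L = O(log n)\<close> bits. The code words have distance at least 3, so that the
  certificates of one block, reached by single flips from the same 0-input, cannot conflict: the
  sensitivity at 0-inputs is at most the number of blocks. Pointers are relative and the decoding is
  invariant under rotation, so that the function is invariant under the cyclic shift of all
  \<open>n^3 L\<close> bits.\<close>

section \<open>Rotation-invariant codes\<close>

definition rotations :: "'a list \<Rightarrow> 'a list set" where
  "rotations w = range (\<lambda>k. rotate k w)"

lemma rotations_rotate1: "rotations (rotate1 w) = rotations w"
proof -
  \<comment> \<open>A total of \<open>length w\<close> rotations is the identity, so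
    \<open>length w - 1\<close> further ones undo \<open>rotate1\<close>.\<close>
  have "rotate k w = rotate (k + (length w - 1)) (rotate1 w)" for k
  proof (cases "w = []")
    case False
    have "rotate (k + (length w - 1)) (rotate1 w) = rotate (k + (length w - 1) + 1) w"
      by (simp only: rotate_rotate[symmetric]) simp
    also have "k + (length w - 1) + 1 = k + length w"
      using False by (cases w) auto
    also have "rotate (k + length w) w = rotate k w"
      by (subst (1 2) rotate_conv_mod) simp
    finally show ?thesis ..
  qed simp
  then have "rotate k w \<in> rotations (rotate1 w)" for k
    unfolding rotations_def by blast
  moreover have "rotate k (rotate1 w) = rotate (Suc k) w" for k
    by (simp add: rotate1_rotate_swap)
  then have "rotate k (rotate1 w) \<in> rotations w" for k
    unfolding rotations_def by blast
  ultimately show ?thesis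
    unfolding rotations_def by blast
qed

lemma card_rotations_le: "w \<noteq> [] \<Longrightarrow> finite (rotations w) \<and> card (rotations w) \<le> length w"
proof -
  assume "w \<noteq> []"
  then have "rotations w \<subseteq> (\<lambda>k. rotate k w) ` {..<length w}"
    unfolding rotations_def by (metis (no_types, lifting) image_eqI image_subsetI lessThan_iff
        length_greater_0_conv mod_less_divisor rotate_conv_mod)
  then show ?thesis
    by (metis card_image_le card_mono finite_imageI finite_lessThan card_lessThan finite_subset le_trans)
qed

text \<open>The classes cover all \<open>2 ^ l\<close> words and each contains at most
  \<open>l\<close> of them, so there must be at least \<open>2 ^ l / l\<close> classes.\<close>

lemma card_rotation_classes:
  assumes "0 < l" "K * l \<le> 2 ^ l"
  shows "K \<le> card (rotations ` {w :: bool list. length w = l})"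
proof -
  let ?W = "{w :: bool list. length w = l}"
  have fin: "finite ?W" and card: "card ?W = 2 ^ l"
    using finite_lists_length_eq[of "UNIV :: bool set" l] card_lists_length_eq[of "UNIV :: bool set" l]
    by simp_all
  have sub: "?W \<subseteq> \<Union> (rotations ` ?W)"
  proof
    fix w assume "w \<in> ?W"
    moreover have "w \<in> rotations w"
      unfolding rotations_def by (rule range_eqI[of _ _ 0]) simp
    ultimately show "w \<in> \<Union> (rotations ` ?W)" by blast
  qed
  have fc: "finite r \<and> card r \<le> l" if "r \<in> rotations ` ?W" for r
    using that assms(1) card_rotations_le by fastforce
  have "K * l \<le> card (\<Union> (rotations ` ?W))"
    using assms(2) card card_mono[OF _ sub] fin fc by (metis finite_Union finite_imageI le_trans)
  also have "\<dots> \<le> (\<Sum>r\<in>rotations ` ?W. card r)"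
    by (rule card_Union_le_sum_card)
  also have "\<dots> \<le> card (rotations ` ?W) * l"
    using fc sum_bounded_above[of "rotations ` ?W" card l] by auto
  finally show ?thesis
    using assms(1) by simp
qed

text \<open>The three copies share their first letter, so moving it from the front of the word to
  its end rotates every copy. Conversely, the last letter of \<open>u\<close> returns to the front
  of each copy.\<close>

lemma rotate1_triple_iff:
  "(\<exists>u. length u = l \<and> rotate1 w = u @ u @ u) \<longleftrightarrow> (\<exists>v. length v = l \<and> w = v @ v @ v)"
  "length v = l \<Longrightarrow> w = v @ v @ v \<Longrightarrow> take l (rotate1 w) = rotate1 v"
proof -
  have fwd: "rotate1 (v @ v @ v) = rotate1 v @ rotate1 v @ rotate1 v" for v :: "'a list"
    by (cases v) auto
  show "take l (rotate1 w) = rotate1 v" if "length v = l" "w = v @ v @ v"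
    using that fwd[of v] by simp
  show "(\<exists>u. length u = l \<and> rotate1 w = u @ u @ u) \<longleftrightarrow> (\<exists>v. length v = l \<and> w = v @ v @ v)"
  proof
    assume "\<exists>u. length u = l \<and> rotate1 w = u @ u @ u"
    then obtain u where u: "length u = l" "rotate1 w = u @ u @ u" by blast
    show "\<exists>v. length v = l \<and> w = v @ v @ v"
    proof (cases w)
      case Nil
      then show ?thesis using u by auto
    next
      case (Cons a t)
      then obtain s b where s: "u = s @ [b]"
        using u by (cases u rule: rev_cases) auto
      then have "w = (b # s) @ (b # s) @ (b # s)"
        using u Cons by auto
      then show ?thesis using s u(1) by (intro exI[of _ "b # s"]) simp
    qed
  next
    assume "\<exists>v. length v = l \<and> w = v @ v @ v"
    then show "\<exists>u. length u = l \<and> rotate1 w = u @ u @ u"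
      using fwd by (metis length_rotate1)
  qed
qed

text \<open>The code words are the repetitions \<open>v @ v @ v\<close>, and such a word stands for
  the number of the rotation class of \<open>v\<close>. Repetition gives the distance: a position
  where \<open>v\<close> and another word differ occurs three times. A symbol may have several code
  words, and these are far apart as well.\<close>

lemma ex_rotation_invariant_code:
  assumes "0 < l" "K * l \<le> 2 ^ l"
  shows "\<exists>dec :: bool list \<Rightarrow> nat option.
    (\<forall>w. dec (rotate1 w) = dec w) \<and>
    (\<forall>s<K. \<exists>w. length w = 3 * l \<and> dec w = Some s) \<and>
    (\<forall>v w. dec v \<noteq> None \<longrightarrow> dec w \<noteq> None \<longrightarrow> v \<noteq> w \<longrightarrow>
      3 \<le> card {t. t < 3 * l \<and> v ! t \<noteq> w ! t})"
proof -
  let ?R = "rotations ` {w :: bool list. length w = l}"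
  have "finite {w :: bool list. length w = l}"
    using finite_lists_length_eq[of "UNIV :: bool set" l] by simp
  then obtain h where h: "bij_betw h {0..<card ?R} ?R"
    using ex_bij_betw_nat_finite by blast
  define num where "num v = inv_into {0..<card ?R} h (rotations v)" for v
  define dec where "dec w = (if \<exists>v. length v = l \<and> w = v @ v @ v then Some (num (take l w)) else None)" for w
  have rot: "dec (rotate1 w) = dec w" for w
  proof (cases "\<exists>v. length v = l \<and> w = v @ v @ v")
    case True
    then obtain v where v: "length v = l" "w = v @ v @ v" by blast
    have "num (take l (rotate1 w)) = num (take l w)"
      using rotate1_triple_iff(2)[OF v] v by (simp add: num_def rotations_rotate1)
    then show ?thesis
      unfolding dec_def rotate1_triple_iff(1) by simp
  next
    case False
    then show ?thesis
      unfolding dec_def rotate1_triple_iff(1) by (simp only: if_False)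
  qed
  have onto: "\<exists>w. length w = 3 * l \<and> dec w = Some s" if "s < K" for s
  proof -
    have s: "s \<in> {0..<card ?R}"
      using card_rotation_classes[OF assms] that by simp
    then have "h s \<in> ?R" using bij_betwE[OF h] by blast
    then obtain v where v: "length v = l" "h s = rotations v" by auto
    have "num v = s"
      unfolding num_def v(2)[symmetric] using h s by (intro inv_into_f_f) (auto simp: bij_betw_def)
    then show ?thesis
      using v(1) by (intro exI[of _ "v @ v @ v"]) (auto simp: dec_def)
  qed
  have dist: "3 \<le> card {t. t < 3 * l \<and> v ! t \<noteq> w ! t}"
    if dv: "dec v \<noteq> None" and dw: "dec w \<noteq> None" and "v \<noteq> w" for v w
  proof -
    obtain a where a: "length a = l" "v = a @ a @ a"
      using dv unfolding dec_def by (auto split: if_splits)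
    obtain b where b: "length b = l" "w = b @ b @ b"
      using dw unfolding dec_def by (auto split: if_splits)
    have "a \<noteq> b" using a b \<open>v \<noteq> w\<close> by blast
    then obtain t where t: "t < l" "a ! t \<noteq> b ! t"
      using a(1) b(1) nth_equalityI[of a b] by auto
    have "{t, t + l, t + 2 * l} \<subseteq> {t. t < 3 * l \<and> v ! t \<noteq> w ! t}"
      using a b t by (auto simp: nth_append)
    from card_mono[OF _ this] show ?thesis
      using t by simp
  qed
  from rot onto dist show ?thesis by blast
qed

section \<open>Pointer certificates\<close>

text \<open>\<open>Junk\<close> is the content of a cell whose bits form no code word. The argument
  of \<open>Ptr\<close> is the absolute target cell, although the bits store an offset.\<close>

datatype symbol = Junk | Inert | Ptr nat

text \<open>The last cell points to itself. This marks the end of the chain, so that the head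
  determines the whole chain.\<close>

fun pointer_chain :: "(nat \<Rightarrow> symbol) \<Rightarrow> nat list \<Rightarrow> bool" where
  "pointer_chain y [] = True"
| "pointer_chain y [t] = (y t = Ptr t)"
| "pointer_chain y (t # u # r) = (y t = Ptr u \<and> pointer_chain y (u # r))"

lemma pointer_chain_Cons:
  "pointer_chain y (t # r) \<longleftrightarrow> y t = Ptr (if r = [] then t else hd r) \<and> pointer_chain y r"
  by (cases r) auto

lemma pointer_chain_appendD: "pointer_chain y (r @ s) \<Longrightarrow> pointer_chain y s"
  by (induction r) (auto simp: pointer_chain_Cons)

lemma pointer_chain_nth: "pointer_chain y r \<Longrightarrow> t \<in> set r \<Longrightarrow> \<exists>u. y t = Ptr u"
  by (induction r) (auto simp: pointer_chain_Cons)

lemma pointer_chain_cong: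
  "(\<And>t. t \<in> set r \<Longrightarrow> y t = z t) \<Longrightarrow> pointer_chain y r \<longleftrightarrow> pointer_chain z r"
  by (induction r) (auto simp: pointer_chain_Cons)

lemma pointer_chain_fun_upd:
  "q \<notin> set r \<Longrightarrow> pointer_chain (y(q := v)) r \<longleftrightarrow> pointer_chain y r"
  by (rule pointer_chain_cong) auto

lemma pointer_chain_map:
  "(\<And>t. t \<in> set r \<Longrightarrow> z (p t) = (case y t of Ptr u \<Rightarrow> Ptr (p u) | s \<Rightarrow> s)) \<Longrightarrow>
    pointer_chain y r \<Longrightarrow> pointer_chain z (map p r)"
  by (induction y r rule: pointer_chain.induct) auto

text \<open>Chains with a common head follow the same pointers. As the cells of a chain are
  distinct, a self-pointer can only be its end, so both chains end together.\<close>

lemma pointer_chain_unique: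
  assumes "pointer_chain y r" "pointer_chain z s" "distinct r" "distinct s"
    and "r \<noteq> []" "s \<noteq> []" "hd r = hd s" "\<And>t. t \<in> set r \<Longrightarrow> t \<in> set s \<Longrightarrow> y t = z t"
  shows "r = s"
  using assms
proof (induction r arbitrary: s)
  case (Cons t r)
  then obtain s' where s: "s = t # s'" by (cases s) auto
  have eq: "(if r = [] then t else hd r) = (if s' = [] then t else hd s')"
    using Cons.prems s by (auto simp: pointer_chain_Cons)
  show ?case
  proof (cases "r = [] \<or> s' = []")
    case True
    then have "r = [] \<and> s' = []"
      using eq Cons.prems(3,4) s by (auto split: if_splits)
    then show ?thesis using s by simp
  next
    case False
    have "r = s'"
      using Cons.prems s False eq
      by (intro Cons.IH) (auto simp: pointer_chain_Cons)
    then show ?thesis using s by simp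
  qed
qed simp

text \<open>With modulus \<open>n ^ 2\<close> this bounds the cells of a column, with modulus
  \<open>n\<close> the columns of a block.\<close>

lemma card_residue_class_le: "card {c. c < m * k \<and> c mod m = a} \<le> (k :: nat)"
proof -
  have "{c. c < m * k \<and> c mod m = a} \<subseteq> (\<lambda>j. m * j + a) ` {..<k}"
  proof
    fix c assume c: "c \<in> {c. c < m * k \<and> c mod m = a}"
    then have "c div m < k" by (auto intro!: less_mult_imp_div_less simp: mult.commute)
    then show "c \<in> (\<lambda>j. m * j + a) ` {..<k}"
      using c mult_div_mod_eq[of m c] by (intro image_eqI[of _ _ "c div m"]) auto
  qed
  from card_mono[OF _ this] have "card {c. c < m * k \<and> c mod m = a} \<le> card ((\<lambda>j. m * j + a) ` {..<k})"
    by simp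
  also have "\<dots> \<le> k" using card_image_le[of "{..<k}"] by auto
  finally show ?thesis .
qed

lemma Suc_mod_eq_iff:
  assumes "0 < m"
  shows "Suc a mod m = Suc b mod m \<longleftrightarrow> a mod m = b mod m"
  using assms by (auto simp: mod_Suc split: if_splits)

section \<open>The pointer function on \<open>n ^ 3\<close> cells of \<open>L\<close> bits\<close>

locale pointer_code =
  fixes n L :: nat and dec :: "bool list \<Rightarrow> nat option"
  assumes n_pos: "0 < n" and L_pos: "0 < L"
    and dec_rotate1: "dec (rotate1 w) = dec w"
    and dec_onto: "s \<le> n ^ 3 \<Longrightarrow> \<exists>w. length w = L \<and> dec w = Some s"
    and dec_distance: "dec v \<noteq> None \<Longrightarrow> dec w \<noteq> None \<Longrightarrow> v \<noteq> w \<Longrightarrow>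
      3 \<le> card {t. t < L \<and> v ! t \<noteq> w ! t}"
begin

abbreviation "M \<equiv> n ^ 3"

abbreviation col :: "nat \<Rightarrow> nat" where "col c \<equiv> c mod n ^ 2"

abbreviation blk :: "nat \<Rightarrow> nat" where "blk c \<equiv> c mod n"

lemma M_pos: "0 < M"
  using n_pos by simp

lemma blk_col: "blk (col c) = blk c"
  by (simp add: mod_mod_cancel power2_eq_square)

lemma blk_eq: "col c = col d \<Longrightarrow> blk c = blk d"
  by (metis blk_col)

text \<open>The covering clause and the length bound together force exactly one cell in each of the
  \<open>n\<close> columns of the block. The clause on the head column makes the start of the chain
  recognizable.\<close>

definition certificate :: "(nat \<Rightarrow> symbol) \<Rightarrow> nat list \<Rightarrow> bool" where
  "certificate y r \<longleftrightarrow> r \<noteq> [] \<and> distinct r \<and> set r \<subseteq> {..<M} \<and> length r \<le> n \<and> pointer_chain y r \<and>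
    (\<forall>c<M. blk c = blk (hd r) \<longrightarrow> (\<exists>t\<in>set r. col t = col c)) \<and>
    (\<forall>c<M. col c = col (hd r) \<longrightarrow> c \<noteq> hd r \<longrightarrow> y c = Inert)"

text \<open>The symbols in these cells decide whether \<open>r\<close> is a certificate.\<close>

definition cert_cells :: "nat list \<Rightarrow> nat set" where
  "cert_cells r = set r \<union> {c. c < M \<and> col c = col (hd r)}"

lemma certificate_cong:
  assumes "certificate y r" "\<And>c. c \<in> cert_cells r \<Longrightarrow> y c = z c"
  shows "certificate z r"
proof -
  have "pointer_chain z r"
    using assms pointer_chain_cong[of r y z] by (auto simp: certificate_def cert_cells_def)
  then show ?thesis
    using assms by (auto simp: certificate_def cert_cells_def)
qed

text \<open>All cells of a certificate thus carry code words, which makes the code distance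
  applicable to them.\<close>

lemma certificate_not_Junk: "certificate y r \<Longrightarrow> c \<in> cert_cells r \<Longrightarrow> y c \<noteq> Junk"
  using pointer_chain_nth[of y r c] pointer_chain_nth[of y r "hd r"]
  by (cases "c = hd r") (auto simp: certificate_def cert_cells_def)

lemma card_cert_cells:
  assumes "certificate y r"
  shows "finite (cert_cells r)" "card (cert_cells r) \<le> 2 * n"
proof -
  show "finite (cert_cells r)" by (simp add: cert_cells_def)
  have "card {c. c < M \<and> col c = col (hd r)} \<le> n"
    using card_residue_class_le[of "n ^ 2" n "col (hd r)"]
    by (simp add: power3_eq_cube power2_eq_square mult.assoc)
  moreover have "card (set r) \<le> n"
    using assms by (simp add: certificate_def distinct_card)
  ultimately show "card (cert_cells r) \<le> 2 * n"
    unfolding cert_cells_def using card_Un_le[of "set r" "{c. c < M \<and> col c = col (hd r)}"] by linarith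
qed

text \<open>The chain of one certificate meets the head column of the other, and it can do so only in
  the head itself. Hence each chain is a suffix of the other.\<close>

lemma certificate_unique:
  assumes r: "certificate y r" and s: "certificate z s" and b: "blk (hd r) = blk (hd s)"
    and eq: "\<And>c. c \<in> cert_cells r \<Longrightarrow> c \<in> cert_cells s \<Longrightarrow> y c = z c"
  shows "r = s"
proof -
  have suffix: "\<exists>v. s = v @ r"
    if r: "certificate y r" and s: "certificate z s" and b: "blk (hd r) = blk (hd s)"
      and eq: "\<And>c. c \<in> cert_cells r \<Longrightarrow> c \<in> cert_cells s \<Longrightarrow> y c = z c" for y z r s
  proof -
    have "hd r < M"
      using r hd_in_set[of r] unfolding certificate_def by blast
    moreover have "\<forall>c<M. blk c = blk (hd s) \<longrightarrow> (\<exists>t\<in>set s. col t = col c)"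
      using s unfolding certificate_def by blast
    ultimately obtain t where t: "t \<in> set s" "col t = col (hd r)"
      using b by blast
    have "t < M" using s t(1) unfolding certificate_def by blast
    moreover have "\<exists>u. y t = Ptr u"
      using pointer_chain_nth[of z s t] s t eq[of t] \<open>t < M\<close>
      by (auto simp: certificate_def cert_cells_def)
    moreover have "\<forall>c<M. col c = col (hd r) \<longrightarrow> c \<noteq> hd r \<longrightarrow> y c = Inert"
      using r unfolding certificate_def by blast
    ultimately have "t = hd r"
      using t(2) by force
    then obtain v w where vw: "s = v @ hd r # w"
      using t(1) split_list[of t s] by blast
    have "r = hd r # w"
    proof (rule pointer_chain_unique)
      show "pointer_chain z (hd r # w)"
        using s vw pointer_chain_appendD[of z v "hd r # w"] unfolding certificate_def by blast
      show "distinct (hd r # w)"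
        using s vw distinct_append[of v "hd r # w"] unfolding certificate_def by blast
      show "y t = z t" if "t \<in> set r" "t \<in> set (hd r # w)" for t
        using that vw by (intro eq) (auto simp: cert_cells_def)
    qed (use r in \<open>auto simp: certificate_def\<close>)
    then show ?thesis using vw by auto
  qed
  obtain v where v: "s = v @ r" using suffix[OF r s b eq] by blast
  obtain w where w: "r = w @ s" using suffix[OF s r b[symmetric] eq[symmetric]] by blast
  have "length r = length w + length v + length r" using v w by (metis length_append add.assoc)
  then show ?thesis using v by simp
qed

text \<open>The bits of a cell lie \<open>M\<close> positions apart instead of side by side. A
  cyclic shift by one bit then carries each cell to the next one, and only the wrap-around from the
  last cell to cell 0 rotates a word. Bit positions start at 1, cells at 0.\<close>

definition word :: "(nat \<Rightarrow> bool) \<Rightarrow> nat \<Rightarrow> bool list" where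
  "word x c = map (\<lambda>t. x (Suc (c + M * t))) [0..<L]"

text \<open>Numbers below \<open>M\<close> are pointer offsets, which do not change when the whole
  array is rotated; offset 0 is the self-pointer. All other numbers mean
  \<open>Inert\<close>.\<close>

definition symbol_at :: "(nat \<Rightarrow> bool) \<Rightarrow> nat \<Rightarrow> symbol" where
  "symbol_at x c = (case dec (word x c) of None \<Rightarrow> Junk
     | Some s \<Rightarrow> if s < M then Ptr ((c + s) mod M) else Inert)"

definition pointer_function :: "(nat \<Rightarrow> bool) \<Rightarrow> bool" where
  "pointer_function x \<longleftrightarrow> (\<exists>r. certificate (symbol_at x) r)"

abbreviation cell_of_bit :: "nat \<Rightarrow> nat" where "cell_of_bit i \<equiv> (i - 1) mod M"

lemma length_word [simp]: "length (word x c) = L"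
  by (simp add: word_def)

lemma nth_word: "t < L \<Longrightarrow> word x c ! t = x (Suc (c + M * t))"
  by (simp add: word_def)

lemma bit_index: "i \<in> {1..M * L} \<Longrightarrow> Suc (cell_of_bit i + M * ((i - 1) div M)) = i"
  by simp

lemma bit_pos_less: "i \<in> {1..M * L} \<Longrightarrow> (i - 1) div M < L"
  by (auto intro!: less_mult_imp_div_less simp: mult.commute)

lemma word_flip_bit_other: "c < M \<Longrightarrow> cell_of_bit i \<noteq> c \<Longrightarrow> word (flip_bit i x) c = word x c"
  by (auto simp: word_def flip_bit_def)

section \<open>Sensitivity\<close>

text \<open>The two words differ in at most two positions, the flipped ones, which is less than the
  code distance.\<close>

lemma word_flip_bits_eq:
  assumes "c < M" "dec (word (flip_bit i x) c) \<noteq> None" "dec (word (flip_bit j x) c) \<noteq> None"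
  shows "word (flip_bit i x) c = word (flip_bit j x) c"
proof (rule ccontr)
  assume neq: "\<not> ?thesis"
  have "{t. t < L \<and> word (flip_bit i x) c ! t \<noteq> word (flip_bit j x) c ! t}
      \<subseteq> {(i - 1) div M, (j - 1) div M}"
  proof
    fix t assume "t \<in> {t. t < L \<and> word (flip_bit i x) c ! t \<noteq> word (flip_bit j x) c ! t}"
    then have "i = Suc (c + M * t) \<or> j = Suc (c + M * t)"
      by (auto simp: nth_word flip_bit_def split: if_splits)
    then show "t \<in> {(i - 1) div M, (j - 1) div M}"
      using assms(1) M_pos by auto
  qed
  from card_mono[OF _ this] have "card {t. t < L \<and> word (flip_bit i x) c ! t \<noteq> word (flip_bit j x) c ! t} \<le> 2"
    by (simp add: card_insert_if split: if_splits)
  then show False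
    using dec_distance[OF assms(2,3) neq] by linarith
qed

lemma symbol_at_not_Junk: "symbol_at x c \<noteq> Junk \<Longrightarrow> dec (word x c) \<noteq> None"
  by (auto simp: symbol_at_def split: option.splits)

lemma cert_cells_less: "certificate y r \<Longrightarrow> c \<in> cert_cells r \<Longrightarrow> c < M"
  by (auto simp: cert_cells_def certificate_def)

text \<open>On common cells both flipped inputs carry code words, which then agree, so the two
  certificates coincide. The flip of bit \<open>i\<close> created the certificate, so this bit lies
  in one of its cells. There the words after both flips are equal, so flipping \<open>j\<close> must
  have changed bit \<open>i\<close> too.\<close>

lemma sensitive_zero_unique:
  assumes x: "\<not> pointer_function x" and i: "i \<in> {1..M * L}"
    and r: "certificate (symbol_at (flip_bit i x)) r"
    and s: "certificate (symbol_at (flip_bit j x)) s"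
    and b: "blk (hd r) = blk (hd s)"
  shows "i = j"
proof (rule ccontr)
  assume "i \<noteq> j"
  have same: "word (flip_bit i x) c = word (flip_bit j x) c"
    if "c \<in> cert_cells r" "c \<in> cert_cells s" for c
    using that certificate_not_Junk[OF r] certificate_not_Junk[OF s] cert_cells_less[OF r]
    by (intro word_flip_bits_eq symbol_at_not_Junk) auto
  have "r = s"
    using same by (intro certificate_unique[OF r s b]) (simp add: symbol_at_def)
  have "\<not> certificate (symbol_at x) r" using x by (auto simp: pointer_function_def)
  then obtain c where c: "c \<in> cert_cells r" "symbol_at (flip_bit i x) c \<noteq> symbol_at x c"
    using certificate_cong[OF r] by blast
  then have ic: "cell_of_bit i = c"
    using word_flip_bit_other[of c i x] cert_cells_less[OF r] by (metis symbol_at_def)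
  have "word (flip_bit i x) c ! ((i - 1) div M) = word (flip_bit j x) c ! ((i - 1) div M)"
    using same c \<open>r = s\<close> by simp
  then have "flip_bit i x i = flip_bit j x i"
    by (simp only: nth_word[OF bit_pos_less[OF i]] ic[symmetric] bit_index[OF i])
  then show False
    using \<open>i \<noteq> j\<close> by (simp add: flip_bit_def)
qed

text \<open>Each sensitive bit is charged to the block of a certificate that its flip creates; no
  block is charged twice.\<close>

lemma card_sensitive_zero:
  assumes "\<not> pointer_function x"
  shows "card {i \<in> {1..M * L}. pointer_function (flip_bit i x)} \<le> n"
proof -
  let ?S = "{i \<in> {1..M * L}. pointer_function (flip_bit i x)}"
  define r where "r i = (SOME r. certificate (symbol_at (flip_bit i x)) r)" for i
  have r: "certificate (symbol_at (flip_bit i x)) (r i)" if "i \<in> ?S" for i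
  proof -
    have "\<exists>r. certificate (symbol_at (flip_bit i x)) r"
      using that unfolding pointer_function_def by blast
    then show ?thesis
      unfolding r_def by (rule someI_ex)
  qed
  have "inj_on (\<lambda>i. blk (hd (r i))) ?S"
  proof (rule inj_onI)
    fix i j assume i: "i \<in> ?S" and j: "j \<in> ?S" and b: "blk (hd (r i)) = blk (hd (r j))"
    have "i \<in> {1..M * L}" using i by blast
    from sensitive_zero_unique[OF assms this r[OF i] r[OF j] b] show "i = j" .
  qed
  moreover have "(\<lambda>i. blk (hd (r i))) ` ?S \<subseteq> {..<n}"
    using n_pos by auto
  ultimately show ?thesis
    using card_inj_on_le[of _ ?S "{..<n}"] by simp
qed

text \<open>Only the bits in the at most \<open>2 * n\<close> cells of one fixed certificate can
  destroy it.\<close>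

lemma card_sensitive_one:
  assumes "pointer_function x"
  shows "card {i \<in> {1..M * L}. \<not> pointer_function (flip_bit i x)} \<le> 2 * n * L"
proof -
  let ?S = "{i \<in> {1..M * L}. \<not> pointer_function (flip_bit i x)}"
  obtain r where r: "certificate (symbol_at x) r"
    using assms by (auto simp: pointer_function_def)
  have cells: "cell_of_bit i \<in> cert_cells r" if "i \<in> ?S" for i
  proof (rule ccontr)
    assume "cell_of_bit i \<notin> cert_cells r"
    then have "word (flip_bit i x) c = word x c" if "c \<in> cert_cells r" for c
      using that cert_cells_less[OF r that] by (intro word_flip_bit_other) auto
    then have "certificate (symbol_at (flip_bit i x)) r"
      by (intro certificate_cong[OF r]) (simp add: symbol_at_def)
    then show False using that by (auto simp: pointer_function_def)
  qed
  have "?S \<subseteq> (\<lambda>(c, t). Suc (c + M * t)) ` (cert_cells r \<times> {..<L})"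
  proof (intro subsetI)
    fix i assume "i \<in> ?S"
    then show "i \<in> (\<lambda>(c, t). Suc (c + M * t)) ` (cert_cells r \<times> {..<L})"
      using cells bit_index[of i] bit_pos_less[of i]
      by (intro image_eqI[of _ _ "(cell_of_bit i, (i - 1) div M)"]) auto
  qed
  then have "card ?S \<le> card ((\<lambda>(c, t). Suc (c + M * t)) ` (cert_cells r \<times> {..<L}))"
    using card_cert_cells(1)[OF r] by (intro card_mono) auto
  also have "\<dots> \<le> card (cert_cells r \<times> {..<L})"
    using card_cert_cells(1)[OF r] by (intro card_image_le) auto
  also have "\<dots> \<le> 2 * n * L"
    using card_cert_cells(2)[OF r] by (simp add: card_cartesian_product)
  finally show ?thesis .
qed

lemma sensitivity_pointer_function: "sensitivity (M * L) pointer_function \<le> 2 * n * L"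
proof -
  have "card {i \<in> {1..M * L}. pointer_function x \<noteq> pointer_function (flip_bit i x)} \<le> 2 * n * L" for x
  proof (cases "pointer_function x")
    case True
    then show ?thesis using card_sensitive_one by simp
  next
    case False
    have "n * 1 \<le> n * (2 * L)"
      using L_pos by (intro mult_le_mono2) simp
    then have "n \<le> 2 * n * L" by (simp only: mult_1_right ac_simps)
    with card_sensitive_zero[OF False]
    have "card {i \<in> {1..M * L}. pointer_function (flip_bit i x)} \<le> 2 * n * L" by (rule le_trans)
    then show ?thesis using False by simp
  qed
  then show ?thesis
    unfolding sensitivity_def using finite_cube cube_nonempty by (subst Max_le_iff) auto
qed

section \<open>Transitivity\<close>

abbreviation next_cell :: "nat \<Rightarrow> nat" where "next_cell c \<equiv> Suc c mod M"

definition shift :: "nat \<Rightarrow> nat" where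
  "shift i = (if i \<in> {1..M * L} then Suc (i mod (M * L)) else i)"

lemma bits_pos: "0 < M * L"
  using M_pos L_pos by simp

lemma shift_funpow: "i \<in> {1..M * L} \<Longrightarrow> (shift ^^ k) i = Suc ((i - 1 + k) mod (M * L))"
proof (induction k)
  case 0
  then show ?case by auto
next
  case (Suc k)
  have "(i - 1 + k) mod (M * L) < M * L"
    by (rule mod_less_divisor[OF bits_pos])
  then have "Suc ((i - 1 + k) mod (M * L)) \<in> {1..M * L}"
    by (simp add: Suc_le_eq)
  then show ?case
    using Suc by (simp add: shift_def mod_Suc_eq)
qed

lemma shift_outside: "i \<notin> {1..M * L} \<Longrightarrow> (shift ^^ k) i = i"
  by (induction k) (auto simp: shift_def)

lemma shift_funpow_id: "shift ^^ (M * L) = id"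
proof
  fix i show "(shift ^^ (M * L)) i = id i"
  proof (cases "i \<in> {1..M * L}")
    case True
    then have "(i - 1 + M * L) mod (M * L) = i - 1"
      by (subst mod_add_self2) auto
    then have "(shift ^^ (M * L)) i = Suc (i - 1)"
      by (simp only: shift_funpow[OF True])
    then show ?thesis using True by simp
  next
    case False
    then show ?thesis by (simp add: shift_outside)
  qed
qed

lemma shift_permutes: "(shift ^^ k) permutes {1..M * L}"
proof -
  \<comment> \<open>The power of \<open>shift\<close> with exponent \<open>l\<close>, one less than
    its period \<open>M * L\<close>, is its inverse.\<close>
  obtain l where l: "M * L = Suc l"
    using bits_pos gr0_implies_Suc by blast
  have "shift ^^ l \<circ> shift = id"
    using shift_funpow_id unfolding l funpow_Suc_right .
  moreover have "shift \<circ> shift ^^ l = id"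
    using shift_funpow_id unfolding l funpow.simps .
  ultimately have "bij shift" by (metis o_bij)
  then have "bij (shift ^^ k)" by (rule bij_fn)
  then have "\<forall>j. \<exists>!i. (shift ^^ k) i = j" unfolding bij_iff .
  moreover have "\<forall>i. i \<notin> {1..M * L} \<longrightarrow> (shift ^^ k) i = i"
    using shift_outside by blast
  ultimately show ?thesis
    unfolding permutes_def by (intro conjI)
qed

text \<open>Bit \<open>t\<close> of a cell other than the last moves to bit \<open>t\<close> of the
  next cell. Bit \<open>t\<close> of the last cell moves to bit \<open>t + 1\<close> of cell 0,
  cyclically in \<open>t\<close>, and the decoding ignores this rotation.\<close>

lemma dec_word_shift:
  assumes "c < M"
  shows "dec (word (x \<circ> shift) c) = dec (word x (next_cell c))"
proof (cases "Suc c < M")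
  case True
  have "word (x \<circ> shift) c = word x (Suc c)"
  proof (rule nth_equalityI)
    fix t assume "t < length (word (x \<circ> shift) c)"
    then have t: "t < L" by simp
    have "M * Suc t \<le> M * L" using t by (intro mult_le_mono2) simp
    then have "Suc (c + M * t) < M * L" using True unfolding mult_Suc_right by linarith
    then show "word (x \<circ> shift) c ! t = word x (Suc c) ! t"
      using t by (simp add: nth_word shift_def)
  qed simp
  then show ?thesis using True by simp
next
  case False
  then have c: "Suc c = M" using assms by simp
  have "word (x \<circ> shift) c = rotate1 (word x 0)"
  proof (rule nth_equalityI)
    fix t assume "t < length (word (x \<circ> shift) c)"
    then have t: "t < L" by simp
    have e: "Suc (c + M * t) = M * Suc t" using c unfolding mult_Suc_right by linarith
    have "M * Suc t \<le> M * L" using t by (intro mult_le_mono2) simp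
    moreover have "1 \<le> M * Suc t" using M_pos unfolding mult_Suc_right by linarith
    ultimately have "shift (M * Suc t) = Suc (M * Suc t mod (M * L))"
      unfolding shift_def by (simp only: atLeastAtMost_iff simp_thms if_True)
    also have "M * Suc t mod (M * L) = M * (Suc t mod L)"
      by (rule mod_mult_mult1)
    finally have "word (x \<circ> shift) c ! t = x (Suc (M * (Suc t mod L)))"
      unfolding nth_word[OF t] o_apply e by simp
    then show "word (x \<circ> shift) c ! t = rotate1 (word x 0) ! t"
      using t L_pos by (simp add: nth_rotate1 nth_word)
  qed simp
  then show ?thesis using c by (simp add: dec_rotate1)
qed

lemma symbol_at_next_cell:
  assumes "c < M"
  shows "symbol_at x (next_cell c) =
    (case symbol_at (x \<circ> shift) c of Ptr u \<Rightarrow> Ptr (next_cell u) | s \<Rightarrow> s)"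
proof -
  have "(Suc c mod M + s) mod M = Suc ((c + s) mod M) mod M" for s
    by (metis add_Suc mod_Suc_eq mod_add_left_eq)
  then show ?thesis
    unfolding symbol_at_def dec_word_shift[OF assms] by (auto split: option.split)
qed

text \<open>Both \<open>n\<close> and \<open>n ^ 2\<close> divide \<open>M\<close>, so the successor
  modulo \<open>M\<close> permutes the columns and the blocks. Relative pointers move along with
  their cells.\<close>

lemma certificate_shift:
  assumes r: "certificate (symbol_at (x \<circ> shift)) r"
  shows "certificate (symbol_at x) (map next_cell r)"
proof -
  have col_next: "col (next_cell c) = Suc c mod n ^ 2" for c
    by (rule mod_mod_cancel) (simp add: le_imp_power_dvd)
  have blk_next: "blk (next_cell c) = Suc c mod n" for c
    by (rule mod_mod_cancel) (simp add: power3_eq_cube)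
  have col_iff: "col (next_cell c) = col (next_cell d) \<longleftrightarrow> col c = col d" for c d
    unfolding col_next using n_pos by (intro Suc_mod_eq_iff) simp
  have blk_iff: "blk (next_cell c) = blk (next_cell d) \<longleftrightarrow> blk c = blk d" for c d
    unfolding blk_next using n_pos by (intro Suc_mod_eq_iff) simp
  have inj: "inj_on next_cell {..<M}"
    using Suc_mod_eq_iff[OF M_pos] by (auto simp: inj_on_def)
  have surj: "\<exists>c'<M. c = next_cell c'" if "c < M" for c
  proof (cases c)
    case 0
    then show ?thesis using M_pos by (intro exI[of _ "M - 1"]) simp
  next
    case (Suc c')
    then show ?thesis using that by (intro exI[of _ c']) simp
  qed
  have r': "r \<noteq> []" "distinct r" "set r \<subseteq> {..<M}" "length r \<le> n"
      "pointer_chain (symbol_at (x \<circ> shift)) r"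
      "\<And>c. c < M \<Longrightarrow> blk c = blk (hd r) \<Longrightarrow> \<exists>t\<in>set r. col t = col c"
      "\<And>c. c < M \<Longrightarrow> col c = col (hd r) \<Longrightarrow> c \<noteq> hd r \<Longrightarrow> symbol_at (x \<circ> shift) c = Inert"
    using r unfolding certificate_def by blast+
  have head: "hd (map next_cell r) = next_cell (hd r)"
    using r'(1) by (simp add: hd_map)
  show ?thesis
    unfolding certificate_def head
  proof (intro conjI allI impI)
    show "distinct (map next_cell r)"
      using r' inj by (simp add: distinct_map inj_on_subset)
    show "set (map next_cell r) \<subseteq> {..<M}"
      using M_pos by auto
    show "pointer_chain (symbol_at x) (map next_cell r)"
    proof (rule pointer_chain_map[OF _ r'(5)])
      fix t assume "t \<in> set r"
      then have "t < M" using r'(3) by blast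
      then show "symbol_at x (next_cell t) =
          (case symbol_at (x \<circ> shift) t of Ptr u \<Rightarrow> Ptr (next_cell u) | s \<Rightarrow> s)"
        by (rule symbol_at_next_cell)
    qed
  next
    fix c assume c: "c < M" "blk c = blk (next_cell (hd r))"
    obtain c' where c': "c' < M" "c = next_cell c'" using surj c(1) by blast
    then obtain t where "t \<in> set r" "col t = col c'"
      using r'(6) c(2) blk_iff by blast
    then show "\<exists>t\<in>set (map next_cell r). col t = col c"
      using c'(2) col_iff by (auto intro!: bexI[of _ t])
  next
    fix c assume c: "c < M" "col c = col (next_cell (hd r))" "c \<noteq> next_cell (hd r)"
    obtain c' where c': "c' < M" "c = next_cell c'" using surj c(1) by blast
    then have "symbol_at (x \<circ> shift) c' = Inert"
      using r'(7) c(2,3) col_iff by blast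
    then show "symbol_at x c = Inert"
      using symbol_at_next_cell[OF c'(1), of x] c'(2) by simp
  qed (use r' in auto)
qed

lemma pointer_function_shift_funpow: "pointer_function (x \<circ> shift ^^ k) = pointer_function x"
proof -
  have unshift: "pointer_function x" if "pointer_function (x \<circ> shift ^^ k)" for k x
    using that
  proof (induction k)
    case (Suc k)
    have "x \<circ> shift ^^ Suc k = (x \<circ> shift ^^ k) \<circ> shift"
      by (simp only: funpow_Suc_right o_assoc)
    then have "pointer_function (x \<circ> shift ^^ k)"
      using Suc.prems certificate_shift unfolding pointer_function_def by metis
    then show ?case by (rule Suc.IH)
  qed simp
  \<comment> \<open>The converse direction: \<open>k * l\<close> further shifts bring the total to
    \<open>k * (M * L)\<close>, which is the identity, and \<open>unshift\<close> applies to
    them.\<close>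
  obtain l where l: "M * L = Suc l"
    using bits_pos gr0_implies_Suc by blast
  have "shift ^^ k \<circ> shift ^^ (k * l) = shift ^^ (k + k * l)"
    by (simp only: funpow_add)
  also have "k + k * l = (M * L) * k"
    unfolding l by simp
  also have "shift ^^ \<dots> = (shift ^^ (M * L)) ^^ k"
    by (rule funpow_mult[symmetric])
  also have "\<dots> = id"
    by (simp only: shift_funpow_id id_funpow)
  finally have "(x \<circ> shift ^^ k) \<circ> shift ^^ (k * l) = x"
    by (simp only: o_assoc[symmetric] comp_id)
  then show ?thesis
    using unshift[of x k] unshift[of "x \<circ> shift ^^ k" "k * l"] by auto
qed

lemma transitive_pointer_function: "transitive_function (M * L) pointer_function"
proof -
  \<comment> \<open>The group is the full invariance group of the function, for which the subgroup
    laws are immediate. The powers of \<open>shift\<close> in it provide transitivity.\<close>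
  let ?G = "{\<sigma>. \<sigma> permutes {1..M * L} \<and> (\<forall>x. pointer_function (x \<circ> \<sigma>) = pointer_function x)}"
  interpret S: group "sym_group (M * L)" by (rule sym_group_is_group)
  have "subgroup ?G (sym_group (M * L))"
  proof (rule S.subgroupI)
    show "?G \<subseteq> carrier (sym_group (M * L))"
      by (auto simp: sym_group_carrier)
    show "?G \<noteq> {}"
      using permutes_id by (auto intro!: exI[of _ id])
  next
    fix \<sigma> assume \<sigma>: "\<sigma> \<in> ?G"
    have "pointer_function (x \<circ> Hilbert_Choice.inv \<sigma>) = pointer_function x" for x
    proof -
      have "(x \<circ> Hilbert_Choice.inv \<sigma>) \<circ> \<sigma> = x"
        using \<sigma> permutes_inv_o(2)[of \<sigma> "{1..M * L}"] by (simp add: o_assoc[symmetric])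
      then show ?thesis using \<sigma> by (metis (mono_tags, lifting) mem_Collect_eq)
    qed
    then show "inv\<^bsub>sym_group (M * L)\<^esub> \<sigma> \<in> ?G"
      using \<sigma> by (simp add: sym_group_inv_equality sym_group_carrier permutes_inv)
  next
    fix \<sigma> \<tau> assume "\<sigma> \<in> ?G" "\<tau> \<in> ?G"
    then show "\<sigma> \<otimes>\<^bsub>sym_group (M * L)\<^esub> \<tau> \<in> ?G"
      by (simp add: sym_group_mult permutes_compose o_assoc)
  qed
  moreover have "\<exists>\<sigma>\<in>?G. \<sigma> i = j" if i: "i \<in> {1..M * L}" and j: "j \<in> {1..M * L}" for i j
  proof -
    \<comment> \<open>This is \<open>j - i\<close> modulo \<open>M * L\<close>, kept
      nonnegative.\<close>
    let ?k = "M * L - i + j"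
    have "i - 1 + ?k = (j - 1) + M * L" using i j by auto
    then have "(shift ^^ ?k) i = Suc ((j - 1) mod (M * L))"
      using shift_funpow[OF i] by simp
    also have "(j - 1) mod (M * L) = j - 1" using j by (intro mod_less) auto
    also have "Suc (j - 1) = j" using j by simp
    finally show ?thesis
      using shift_permutes pointer_function_shift_funpow by blast
  qed
  ultimately show ?thesis
    unfolding transitive_function_def transitive_perm_group_def by (intro exI[of _ ?G]) auto
qed

section \<open>Query complexity\<close>

text \<open>These are the assignments of symbols to cells that survive encoding and decoding, so
  that the adversary can work with symbols instead of bits.\<close>

definition valid :: "(nat \<Rightarrow> symbol) \<Rightarrow> bool" where
  "valid y \<longleftrightarrow> (\<forall>c. y c \<noteq> Junk \<and> (\<forall>u. y c = Ptr u \<longrightarrow> u < M))"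

text \<open>A pointer from \<open>c\<close> to \<open>u\<close> is stored as \<open>u - c\<close>
  modulo \<open>M\<close>; the sum \<open>u + (M - c)\<close> avoids truncated subtraction when
  \<open>c < M\<close>. The number \<open>M\<close> encodes \<open>Inert\<close>.\<close>

definition code :: "nat \<Rightarrow> symbol \<Rightarrow> bool list" where
  "code c s = (SOME w. length w = L \<and>
     dec w = Some (case s of Ptr u \<Rightarrow> (u + (M - c)) mod M | _ \<Rightarrow> M))"

definition encode :: "(nat \<Rightarrow> symbol) \<Rightarrow> nat \<Rightarrow> bool" where
  "encode y = (\<lambda>i\<in>{1..M * L}. code (cell_of_bit i) (y (cell_of_bit i)) ! ((i - 1) div M))"

lemma code_spec:
  "length (code c s) = L \<and> dec (code c s) = Some (case s of Ptr u \<Rightarrow> (u + (M - c)) mod M | _ \<Rightarrow> M)"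
proof -
  have "(case s of Ptr u \<Rightarrow> (u + (M - c)) mod M | _ \<Rightarrow> M) \<le> M"
    using mod_less_divisor[OF M_pos] by (auto split: symbol.split intro: less_imp_le)
  from someI_ex[OF dec_onto[OF this]] show ?thesis
    unfolding code_def .
qed

lemma encode_in_cube: "encode y \<in> cube (M * L)"
  unfolding encode_def cube_def by (rule restrict_PiE_iff[THEN iffD2]) simp

lemma encode_cong: "y (cell_of_bit i) = z (cell_of_bit i) \<Longrightarrow> encode y i = encode z i"
  by (simp add: encode_def)

lemma word_encode:
  assumes "c < M"
  shows "word (encode y) c = code c (y c)"
proof (rule nth_equalityI)
  show "length (word (encode y) c) = length (code c (y c))"
    using code_spec by simp
  fix t assume "t < length (word (encode y) c)"
  then have t: "t < L" by simp
  then have "M * Suc t \<le> M * L" by (intro mult_le_mono2) simp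
  then have "Suc (c + M * t) \<in> {1..M * L}"
    using assms unfolding mult_Suc_right by auto
  then show "word (encode y) c ! t = code c (y c) ! t"
    using assms M_pos by (simp add: nth_word t encode_def)
qed

lemma symbol_at_encode:
  assumes "valid y" "c < M"
  shows "symbol_at (encode y) c = y c"
proof (cases "y c")
  case (Ptr u)
  then have u: "u < M" using assms by (auto simp: valid_def)
  have "(c + (u + (M - c)) mod M) mod M = (u + M) mod M"
    using assms(2) by (simp add: mod_add_right_eq)
  then show ?thesis
    using Ptr u mod_less_divisor[OF M_pos] assms(2)
    by (simp add: symbol_at_def word_encode code_spec)
qed (use assms in \<open>auto simp: symbol_at_def word_encode code_spec valid_def\<close>)

lemma pointer_function_encode:
  assumes "valid y"
  shows "pointer_function (encode y) \<longleftrightarrow> (\<exists>r. certificate y r)"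
  unfolding pointer_function_def
  using certificate_cong[of "symbol_at (encode y)" _ y] certificate_cong[of y _ "symbol_at (encode y)"]
    symbol_at_encode[OF assms] cert_cells_less by metis

section \<open>The adversary against decision trees\<close>

definition column :: "nat \<Rightarrow> nat set" where
  "column c = {d. d < M \<and> col d = col c}"

definition block :: "nat \<Rightarrow> nat set" where
  "block b = {d. d < M \<and> blk d = b}"

text \<open>The adversary answers \<open>Inert\<close> except for the last cell of a column, which points to the last
  cell of the column of the same block completed before. The last cell of a block is \<open>Inert\<close> again,
  which leaves the block without a certificate.\<close>

definition open_block :: "nat set \<Rightarrow> (nat \<Rightarrow> symbol) \<Rightarrow> nat \<Rightarrow> nat list \<Rightarrow> bool" where
  "open_block Q y b r \<longleftrightarrow> \<not> block b \<subseteq> Q \<and> distinct (map col r) \<and> pointer_chain y r \<and>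
    set r \<subseteq> block b \<and> (\<forall>t\<in>set r. column t \<subseteq> Q) \<and>
    (\<forall>c\<in>block b. column c \<subseteq> Q \<longrightarrow> (\<exists>t\<in>set r. col t = col c)) \<and>
    (\<forall>c\<in>Q \<inter> block b. c \<notin> set r \<longrightarrow> y c = Inert)"

definition closed_block :: "nat set \<Rightarrow> (nat \<Rightarrow> symbol) \<Rightarrow> nat \<Rightarrow> bool" where
  "closed_block Q y b \<longleftrightarrow> block b \<subseteq> Q \<and> (\<exists>c\<in>block b. \<forall>d\<in>column c. y d = Inert)"

definition adversary_state :: "nat set \<Rightarrow> (nat \<Rightarrow> symbol) \<Rightarrow> bool" where
  "adversary_state Q y \<longleftrightarrow> Q \<subseteq> {..<M} \<and> valid y \<and>
    (\<forall>b<n. closed_block Q y b \<or> (\<exists>r. open_block Q y b r))"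

lemma column_cong: "col c = col d \<Longrightarrow> column c = column d"
  by (simp add: column_def)

lemma column_subset_block: "column c \<subseteq> block (blk c)"
proof
  fix d assume "d \<in> column c"
  then have "d < M" "col d = col c" by (simp_all add: column_def)
  then show "d \<in> block (blk c)"
    using blk_eq[of d c] by (simp add: block_def)
qed

lemma adversary_state_init: "adversary_state {} (\<lambda>_. Inert)"
proof -
  have "open_block {} (\<lambda>_. Inert) b []" if "b < n" for b
  proof -
    have "b < M" using that self_le_power[of n 3] n_pos by simp
    then have "b \<in> block b" using that by (simp add: block_def)
    moreover have "c \<in> column c" if "c \<in> block b" for c
      using that by (simp add: block_def column_def)
    ultimately show ?thesis by (auto simp: open_block_def)
  qed
  then show ?thesis by (auto simp: adversary_state_def valid_def)
qed

lemma open_block_col_neq: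
  assumes "open_block Q y b r" "q \<in> block b" "q \<notin> Q" "t \<in> set r"
  shows "col t \<noteq> col q"
proof
  assume "col t = col q"
  then have "q \<in> column t" using assms(2) by (simp add: column_def block_def)
  then show False using assms unfolding open_block_def by blast
qed

lemma open_block_other:
  assumes "open_block Q y b r" "blk q \<noteq> b"
  shows "open_block (insert q Q) (y(q := v)) b r"
proof -
  have q: "q \<notin> block b" using assms(2) by (simp add: block_def)
  have "q \<notin> column c" if "c \<in> block b" for c
    using that q column_subset_block[of c] by (auto simp: block_def)
  moreover have "pointer_chain (y(q := v)) r"
    using assms q unfolding open_block_def by (subst pointer_chain_fun_upd) auto
  ultimately show ?thesis
    using assms q unfolding open_block_def by (auto simp: subset_insert)
qed

lemma closed_block_other:
  assumes "closed_block Q y b" "blk q \<noteq> b"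
  shows "closed_block (insert q Q) (y(q := v)) b"
proof -
  have "q \<notin> column c" if "c \<in> block b" for c
    using that assms(2) column_subset_block[of c] by (auto simp: block_def)
  then show ?thesis
    using assms(1) unfolding closed_block_def by (metis fun_upd_other subset_insertI2)
qed

lemma open_block_step:
  assumes r: "open_block Q y b r" and q: "q \<in> block b" "q \<notin> Q"
  shows "\<exists>v. (v = Inert \<or> (\<exists>u<M. v = Ptr u)) \<and>
    (closed_block (insert q Q) (y(q := v)) b \<or> (\<exists>r'. open_block (insert q Q) (y(q := v)) b r'))"
proof -
  have ql: "q < M" "blk q = b" using q by (auto simp: block_def)
  have q_in: "q \<in> column q" using ql by (simp add: column_def)
  have r': "\<not> block b \<subseteq> Q" "distinct (map col r)" "pointer_chain y r" "set r \<subseteq> block b"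
    "\<And>t. t \<in> set r \<Longrightarrow> column t \<subseteq> Q"
    "\<And>c. c \<in> block b \<Longrightarrow> column c \<subseteq> Q \<Longrightarrow> \<exists>t\<in>set r. col t = col c"
    "\<And>c. c \<in> Q \<Longrightarrow> c \<in> block b \<Longrightarrow> c \<notin> set r \<Longrightarrow> y c = Inert"
    using r unfolding open_block_def by blast+
  have neq: "col t \<noteq> col q" if "t \<in> set r" for t
    using open_block_col_neq[OF r q that] .
  then have q_notin: "q \<notin> set r" by blast
  then have chain: "pointer_chain (y(q := v)) r" for v
    using r'(3) by (simp add: pointer_chain_fun_upd)
  have col_sub: "column c \<subseteq> Q" if "column c \<subseteq> insert q Q" "col c \<noteq> col q" for c
    using that by (auto simp: column_def)
  \<comment> \<open>The queried cell leaves its column incomplete, or completes its column but not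
    the block, or completes the block. The answers are \<open>Inert\<close>, a pointer, and
    \<open>Inert\<close>.\<close>
  consider (col) "\<not> column q \<subseteq> insert q Q" | (ptr) "column q \<subseteq> insert q Q" "\<not> block b \<subseteq> insert q Q"
    | (last) "block b \<subseteq> insert q Q" by blast
  then show ?thesis
  proof cases
    case col
    have "open_block (insert q Q) (y(q := Inert)) b r"
      unfolding open_block_def
    proof (intro conjI ballI impI)
      show "\<not> block b \<subseteq> insert q Q"
        using col column_subset_block[of q] ql by blast
      show "\<exists>t\<in>set r. col t = col c" if c: "c \<in> block b" "column c \<subseteq> insert q Q" for c
      proof -
        have "col c \<noteq> col q" using c col column_cong by metis
        then show ?thesis using r'(6)[OF c(1)] col_sub[OF c(2)] by blast
      qed
      show "(y(q := Inert)) c = Inert" if "c \<in> insert q Q \<inter> block b" "c \<notin> set r" for c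
        using that r'(7) by auto
    qed (use r' chain in auto)
    then show ?thesis by blast
  next
    case ptr
    \<comment> \<open>The list \<open>r\<close> has the latest completed column first. The first
      completed column of a block gets the self-pointer that ends the chain.\<close>
    let ?u = "if r = [] then q else hd r"
    have "?u < M"
      using r'(4) ql by (cases r) (auto simp: block_def)
    moreover have "open_block (insert q Q) (y(q := Ptr ?u)) b (q # r)"
      unfolding open_block_def
    proof (intro conjI ballI impI)
      show "distinct (map col (q # r))"
        using r'(2) neq by (fastforce simp: distinct_map)
      show "pointer_chain (y(q := Ptr ?u)) (q # r)"
        using chain by (simp add: pointer_chain_Cons)
      show "column t \<subseteq> insert q Q" if "t \<in> set (q # r)" for t
        using that ptr(1) r'(5) by auto
      show "\<exists>t\<in>set (q # r). col t = col c" if c: "c \<in> block b" "column c \<subseteq> insert q Q" for c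
      proof (cases "col c = col q")
        case False
        then show ?thesis using r'(6)[OF c(1)] col_sub[OF c(2)] by auto
      qed simp
      show "(y(q := Ptr ?u)) c = Inert" if "c \<in> insert q Q \<inter> block b" "c \<notin> set (q # r)" for c
        using that r'(7) by auto
    qed (use r' ptr q in auto)
    ultimately show ?thesis by blast
  next
    case last
    \<comment> \<open>No chain cell lies in the column of \<open>q\<close>, so this column becomes
      entirely inert.\<close>
    have "(y(q := Inert)) d = Inert" if d: "d \<in> column q" for d
    proof (cases "d = q")
      case False
      have "d \<in> block b" using d column_subset_block[of q] ql by blast
      moreover have "d \<notin> set r" using neq[of d] d by (auto simp: column_def)
      ultimately show ?thesis using False r'(7) last by auto
    qed simp
    then have "closed_block (insert q Q) (y(q := Inert)) b"
      using last q(1) unfolding closed_block_def by blast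
    then show ?thesis by blast
  qed
qed

lemma adversary_state_step:
  assumes "adversary_state Q y" "q < M" "q \<notin> Q"
  shows "\<exists>v. adversary_state (insert q Q) (y(q := v))"
proof -
  have st: "Q \<subseteq> {..<M}" "valid y" "\<And>b. b < n \<Longrightarrow> closed_block Q y b \<or> (\<exists>r. open_block Q y b r)"
    using assms(1) unfolding adversary_state_def by blast+
  have q: "q \<in> block (blk q)" "blk q < n"
    using assms(2) n_pos by (auto simp: block_def)
  have "\<not> closed_block Q y (blk q)"
    using q(1) assms(3) by (auto simp: closed_block_def)
  then obtain r where "open_block Q y (blk q) r" using st(3)[OF q(2)] by blast
  from open_block_step[OF this q(1) assms(3)] obtain v where
    v: "v = Inert \<or> (\<exists>u<M. v = Ptr u)"
      "closed_block (insert q Q) (y(q := v)) (blk q) \<or> (\<exists>r'. open_block (insert q Q) (y(q := v)) (blk q) r')"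
    by blast
  have "closed_block (insert q Q) (y(q := v)) b \<or> (\<exists>r. open_block (insert q Q) (y(q := v)) b r)"
    if "b < n" for b
    using v(2) st(3)[OF that] open_block_other closed_block_other by metis
  moreover have "valid (y(q := v))"
    using st(2) v(1) by (auto simp: valid_def)
  ultimately show ?thesis
    using st(1) assms(2) by (auto simp: adversary_state_def intro!: exI[of _ v])
qed

text \<open>The adversary goes on answering unread cells until a single one is left, whose symbol
  will decide the value.\<close>

lemma adversary_state_extend:
  assumes "adversary_state Q y" "card Q < M"
  shows "\<exists>e<M. e \<notin> Q \<and> (\<exists>z. adversary_state ({..<M} - {e}) z \<and> (\<forall>c\<in>Q. z c = y c))"
  using assms
proof (induction "M - card Q" arbitrary: Q y rule: less_induct)
  case less
  have Q: "Q \<subseteq> {..<M}" using less.prems by (simp add: adversary_state_def)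
  then have fin: "finite Q" using finite_subset by blast
  have "Q \<noteq> {..<M}" using less.prems(2) by auto
  then obtain q where q: "q < M" "q \<notin> Q" using Q by blast
  show ?case
  proof (cases "insert q Q = {..<M}")
    case True
    then have "Q = {..<M} - {q}" using q by blast
    then show ?thesis using less.prems(1) q by blast
  next
    case False
    obtain v where v: "adversary_state (insert q Q) (y(q := v))"
      using adversary_state_step[OF less.prems(1) q] by blast
    have "insert q Q \<subset> {..<M}" using False q(1) Q by blast
    then have "card (insert q Q) < M" using psubset_card_mono[of "{..<M}"] by simp
    moreover have "M - card (insert q Q) < M - card Q"
      using less.prems(2) q(2) fin by simp
    ultimately obtain e z where e: "e < M" "e \<notin> insert q Q" "adversary_state ({..<M} - {e}) z"
        "\<forall>c\<in>insert q Q. z c = (y(q := v)) c"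
      using less.hyps[of "insert q Q" "y(q := v)"] v by blast
    then have "\<forall>c\<in>Q. z c = y c" using q(2) by auto
    then show ?thesis using e by blast
  qed
qed

text \<open>With every cell read, all blocks are closed. A chain would have to meet the inert column
  of its block, but its cells are pointers.\<close>

lemma adversary_state_full:
  assumes "adversary_state {..<M} y"
  shows "\<not> certificate y r"
proof
  assume r: "certificate y r"
  have "hd r < M" using r hd_in_set[of r] unfolding certificate_def by blast
  have "blk (hd r) < n" using n_pos by simp
  moreover have "\<not> open_block {..<M} y b s" for b s
    by (auto simp: open_block_def block_def)
  ultimately obtain c where c: "c \<in> block (blk (hd r))" "\<forall>d\<in>column c. y d = Inert"
    using assms unfolding adversary_state_def closed_block_def by blast
  then have "c < M" "blk c = blk (hd r)" by (auto simp: block_def)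
  then obtain t where t: "t \<in> set r" "col t = col c"
    using r unfolding certificate_def by blast
  then have "t \<in> column c" using r by (auto simp: column_def certificate_def)
  then show False
    using c(2) pointer_chain_nth[of y r t] r t(1) by (auto simp: certificate_def)
qed

text \<open>All columns of the block except that of \<open>e\<close> are complete and therefore on
  the chain. A pointer at \<open>e\<close> adds the missing column as the head, and the other cells
  of this column are inert.\<close>

lemma last_column_certificate:
  assumes r: "open_block ({..<M} - {e}) y (blk e) r" and e: "e < M"
  shows "certificate (y(e := Ptr (if r = [] then e else hd r))) (e # r)"
proof -
  let ?Q = "{..<M} - {e}"
  let ?u = "if r = [] then e else hd r"
  have r': "distinct (map col r)" "pointer_chain y r" "set r \<subseteq> block (blk e)"
    "\<And>c. c \<in> block (blk e) \<Longrightarrow> column c \<subseteq> ?Q \<Longrightarrow> \<exists>t\<in>set r. col t = col c"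
    "\<And>c. c \<in> ?Q \<Longrightarrow> c \<in> block (blk e) \<Longrightarrow> c \<notin> set r \<Longrightarrow> y c = Inert"
    using r unfolding open_block_def by blast+
  have eb: "e \<in> block (blk e)" using e by (simp add: block_def)
  have neq: "col t \<noteq> col e" if "t \<in> set r" for t
    using open_block_col_neq[OF r eb _ that] by blast
  have dist: "distinct (map col (e # r))" using r'(1) neq by (fastforce simp: distinct_map)
  have sub: "set (e # r) \<subseteq> block (blk e)" using r'(3) eb by simp
  have "col c < n ^ 2 \<and> blk (col c) = blk e" if "c \<in> block (blk e)" for c
    using that n_pos blk_col by (simp add: block_def)
  \<comment> \<open>The chain cells lie in distinct columns of one block, so their number is at most
    \<open>n\<close>.\<close>
  then have "set (map col (e # r)) \<subseteq> {a. a < n * n \<and> a mod n = blk e}"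
    using sub by (auto simp: power2_eq_square)
  then have "card (set (map col (e # r))) \<le> card {a. a < n * n \<and> a mod n = blk e}"
    by (intro card_mono) auto
  also have "\<dots> \<le> n" by (rule card_residue_class_le)
  finally have len: "length (e # r) \<le> n"
    using distinct_card[OF dist] by simp
  show ?thesis
    unfolding certificate_def list.sel
  proof (intro conjI allI impI)
    show "distinct (e # r)" using dist distinct_map by blast
    show "set (e # r) \<subseteq> {..<M}" using sub by (auto simp: block_def)
    have "e \<notin> set r" using neq by blast
    then show "pointer_chain (y(e := Ptr ?u)) (e # r)"
      using r'(2) by (simp add: pointer_chain_fun_upd pointer_chain_Cons)
    show "\<exists>t\<in>set (e # r). col t = col c" if c: "c < M" "blk c = blk e" for c
    proof (cases "col c = col e")
      case False
      then have "column c \<subseteq> ?Q" by (auto simp: column_def)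
      then show ?thesis using r'(4)[of c] c by (auto simp: block_def)
    qed simp
    show "(y(e := Ptr ?u)) c = Inert" if c: "c < M" "col c = col e" "c \<noteq> e" for c
      using c r'(5)[of c] neq[of c] blk_eq[OF c(2)] by (auto simp: block_def)
  qed (use len in auto)
qed

text \<open>A pointer in the last unread cell completes a certificate, while the adversary's own
  answer there closes the last block and leaves none.\<close>

lemma adversary_state_undecided:
  assumes "adversary_state Q y" "card Q < M"
  shows "\<exists>z. valid z \<and> (\<forall>c\<in>Q. z c = y c) \<and> (\<exists>r. certificate z r) = b"
proof -
  obtain e z where e: "e < M" "e \<notin> Q" and z: "adversary_state ({..<M} - {e}) z" "\<forall>c\<in>Q. z c = y c"
    using adversary_state_extend[OF assms] by blast
  show ?thesis
  proof (cases b)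
    case True
    have "blk e < n" using n_pos by simp
    moreover have "\<not> closed_block ({..<M} - {e}) z (blk e)"
      using e(1) by (auto simp: closed_block_def block_def)
    ultimately obtain r where r: "open_block ({..<M} - {e}) z (blk e) r"
      using z(1) unfolding adversary_state_def by blast
    define u where "u = (if r = [] then e else hd r)"
    have "u < M"
      unfolding u_def using r e(1) by (cases r) (auto simp: open_block_def block_def)
    then have "valid (z(e := Ptr u))"
      using z(1) unfolding adversary_state_def valid_def by simp
    moreover have "\<forall>c\<in>Q. (z(e := Ptr u)) c = y c" using z(2) e(2) by auto
    ultimately show ?thesis
      using last_column_certificate[OF r e(1), folded u_def] True by blast
  next
    case False
    have "insert e ({..<M} - {e}) = {..<M}" using e(1) by auto
    then obtain v where v: "adversary_state {..<M} (z(e := v))"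
      using adversary_state_step[OF z(1) e(1)] by auto
    then have "valid (z(e := v))" by (simp add: adversary_state_def)
    moreover have "\<forall>c\<in>Q. (z(e := v)) c = y c" using z(2) e(2) by auto
    ultimately show ?thesis
      using adversary_state_full[OF v] False by blast
  qed
qed

text \<open>\<open>Q\<close> holds the cells disclosed so far. A query of a bit discloses its whole
  cell, so each query adds at most one cell to \<open>Q\<close>, and a tree that answers before
  \<open>Q\<close> is full errs on some consistent input.\<close>

lemma adversary_wins:
  assumes "adversary_state Q y"
  shows "\<exists>z. valid z \<and> (\<forall>c\<in>Q. z c = y c) \<and>
    (M \<le> num_queries t (encode z) + card Q \<or> dt_output t (encode z) \<noteq> pointer_function (encode z))"
  using assms
proof (induction t arbitrary: Q y)
  case (Answer b)
  show ?case
  proof (cases "card Q < M")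
    case True
    obtain z where "valid z" "\<forall>c\<in>Q. z c = y c" "(\<exists>r. certificate z r) = (\<not> b)"
      using adversary_state_undecided[OF Answer True] by blast
    then show ?thesis using pointer_function_encode by auto
  next
    case False
    then show ?thesis using Answer by (auto simp: adversary_state_def)
  qed
next
  case (Query i t0 t1)
  let ?c = "cell_of_bit i"
  have c: "?c < M" by (rule mod_less_divisor[OF M_pos])
  have fin: "finite Q" using Query.prems finite_subset by (auto simp: adversary_state_def)
  obtain y' where y': "adversary_state (insert ?c Q) y'" "\<forall>c\<in>Q. y' c = y c"
  proof (cases "?c \<in> Q")
    case True
    then show ?thesis using that[of y] Query.prems by (simp add: insert_absorb)
  next
    case False
    then obtain v where "adversary_state (insert ?c Q) (y(?c := v))"
      using adversary_state_step[OF Query.prems c] by blast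
    then show ?thesis using that[of "y(?c := v)"] False by auto
  qed
  \<comment> \<open>The cell of bit \<open>i\<close> is now fixed, so every consistent
    \<open>z\<close> follows the same branch.\<close>
  define t where "t = (if encode y' i then t1 else t0)"
  obtain z where z: "valid z" "\<forall>c\<in>insert ?c Q. z c = y' c"
      "M \<le> num_queries t (encode z) + card (insert ?c Q) \<or> dt_output t (encode z) \<noteq> pointer_function (encode z)"
    using Query.IH(1)[OF y'(1)] Query.IH(2)[OF y'(1)] unfolding t_def by (cases "encode y' i") auto
  have "encode z i = encode y' i" using z(2) by (intro encode_cong) blast
  then have "num_queries (Query i t0 t1) (encode z) = Suc (num_queries t (encode z))"
      "dt_output (Query i t0 t1) (encode z) = dt_output t (encode z)"
    by (simp_all add: t_def)
  moreover have "card (insert ?c Q) \<le> Suc (card Q)" by (rule card_insert_le_m1) auto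
  moreover have "\<forall>c\<in>Q. z c = y c" using z(2) y'(2) by simp
  ultimately show ?case using z(1,3) by (intro exI[of _ z]) auto
qed

lemma query_complexity_pointer_function: "M \<le> query_complexity (M * L) pointer_function"
proof -
  have "M \<le> worst_case_queries (M * L) t" if t: "computes (M * L) t pointer_function" for t
  proof -
    obtain z where "M \<le> num_queries t (encode z) \<or> dt_output t (encode z) \<noteq> pointer_function (encode z)"
      using adversary_wins[OF adversary_state_init, of t] by auto
    then have "M \<le> num_queries t (encode z)"
      using t encode_in_cube unfolding computes_def by blast
    also have "\<dots> \<le> worst_case_queries (M * L) t"
      unfolding worst_case_queries_def using finite_cube encode_in_cube by (intro Max_ge) auto
    finally show ?thesis .
  qed
  moreover have "\<exists>d t. computes (M * L) t pointer_function \<and> worst_case_queries (M * L) t = d"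
    using ex_computes by blast
  from LeastI_ex[OF this] obtain t where "computes (M * L) t pointer_function"
      "worst_case_queries (M * L) t = query_complexity (M * L) pointer_function"
    unfolding query_complexity_def by blast
  ultimately show ?thesis by metis
qed

end

section \<open>Choice of parameters and asymptotics\<close>

lemma ex_pointer_code: "\<exists>dec. pointer_code (2 ^ i) (18 * i + 12) dec"
proof -
  \<comment> \<open>With \<open>n = 2 ^ i\<close>, the \<open>n ^ 3 + 1\<close> symbols number at
    most \<open>2 ^ (3 * i + 1)\<close>, and \<open>?l\<close> is at most
    \<open>2 ^ (3 * i + 3)\<close>. The exponents add up to exactly \<open>?l\<close>, so there are
    enough rotation classes; three copies give \<open>18 * i + 12\<close> bits.\<close>
  let ?l = "2 * (3 * i + 2)"
  have "3 * i + 2 < 2 ^ (3 * i + 2)" by (rule less_exp)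
  moreover have "(2 ^ i) ^ 3 + 1 \<le> (2 :: nat) ^ (3 * i + 1)"
    by (simp add: power_mult[symmetric] mult.commute)
  ultimately have "((2 ^ i) ^ 3 + 1) * ?l \<le> 2 ^ (3 * i + 1) * (2 * 2 ^ (3 * i + 2))"
    by (intro mult_le_mono) auto
  also have "\<dots> = 2 ^ (3 * i + 1 + Suc (3 * i + 2))"
    by (simp only: power_add power_Suc)
  also have "3 * i + 1 + Suc (3 * i + 2) = ?l" by simp
  finally have bound: "((2 ^ i) ^ 3 + 1) * ?l \<le> 2 ^ ?l" .
  have "0 < ?l" and L: "3 * ?l = 18 * i + 12" by simp_all
  from ex_rotation_invariant_code[OF this(1) bound] obtain dec :: "bool list \<Rightarrow> nat option" where
    rot: "\<forall>w. dec (rotate1 w) = dec w" and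
    onto: "\<forall>s<(2 ^ i) ^ 3 + 1. \<exists>w. length w = 18 * i + 12 \<and> dec w = Some s" and
    dist: "\<forall>v w. dec v \<noteq> None \<longrightarrow> dec w \<noteq> None \<longrightarrow> v \<noteq> w \<longrightarrow>
      3 \<le> card {t. t < 18 * i + 12 \<and> v ! t \<noteq> w ! t}"
    unfolding L by blast
  have "pointer_code (2 ^ i) (18 * i + 12) dec"
  proof
    show "\<exists>w. length w = 18 * i + 12 \<and> dec w = Some s" if "s \<le> (2 ^ i) ^ 3" for s
      using onto that by simp
    show "3 \<le> card {t. t < 18 * i + 12 \<and> v ! t \<noteq> w ! t}"
      if "dec v \<noteq> None" "dec w \<noteq> None" "v \<noteq> w" for v w
      using dist that by blast
  qed (use rot in simp_all)
  then show ?thesis by blast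
qed

theorem theorem1p2:
  shows "\<exists>(N :: nat \<Rightarrow> nat) (F :: nat \<Rightarrow> (nat \<Rightarrow> bool) \<Rightarrow> bool).
    (\<forall>i. transitive_function (N i) (F i)) \<and>
    filterlim N at_top sequentially \<and>
    filterlim (\<lambda>i. query_complexity (N i) (F i)) at_top sequentially \<and>
    soft_Omega N
      (\<lambda>i. real (query_complexity (N i) (F i)))
      (\<lambda>i. real (sensitivity (N i) (F i)) ^ 3)"
proof -
  obtain dec where dec: "\<And>i. pointer_code (2 ^ i) (18 * i + 12) (dec i)"
    using ex_pointer_code by metis
  define N :: "nat \<Rightarrow> nat" where "N i = (2 ^ i) ^ 3 * (18 * i + 12)" for i
  define F where "F i = pointer_code.pointer_function (2 ^ i) (18 * i + 12) (dec i)" for i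
  have trans: "transitive_function (N i) (F i)" for i
    unfolding N_def F_def by (rule pointer_code.transitive_pointer_function[OF dec])
  have D: "(2 ^ i) ^ 3 \<le> query_complexity (N i) (F i)" for i
    unfolding N_def F_def by (rule pointer_code.query_complexity_pointer_function[OF dec])
  have s: "sensitivity (N i) (F i) \<le> 2 * 2 ^ i * (18 * i + 12)" for i
    unfolding N_def F_def by (rule pointer_code.sensitivity_pointer_function[OF dec])
  have i_le: "i \<le> (2 ^ i) ^ 3" for i :: nat
    using less_imp_le[OF less_exp[of i]] self_le_power[of "2 ^ i :: nat" 3]
    by (rule le_trans) auto
  have "i \<le> N i" for i
    using mult_le_mono[OF i_le[of i], of 1 "18 * i + 12"] by (simp add: N_def)
  then have N_top: "filterlim N at_top sequentially"
    by (intro filterlim_at_top_mono[OF filterlim_ident]) auto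
  have "i \<le> query_complexity (N i) (F i)" for i
    using i_le[of i] D[of i] by (rule le_trans)
  then have D_top: "filterlim (\<lambda>i. query_complexity (N i) (F i)) at_top sequentially"
    by (intro filterlim_at_top_mono[OF filterlim_ident]) auto
  \<comment> \<open>For \<open>i\<close> at least 1, \<open>18 * i + 12\<close> is at most
    \<open>30 * i\<close>, and \<open>i\<close> is at most \<open>ln (N i)\<close>. The sensitivity
    is therefore at most \<open>60 * 2 ^ i * ln (N i)\<close>, and 216000 is the cube of 60.\<close>
  have "1 / 216000 * real (sensitivity (N i) (F i)) ^ 3 / ln (real (N i)) powr 3
      \<le> real (query_complexity (N i) (F i))" if i: "1 \<le> i" for i
  proof -
    have "1 / 2 \<le> ln (2 :: real)"
      using ln_le_minus_one[of "1 / 2 :: real"] by (simp add: ln_div)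
    then have "3 * real i * (1 / 2) \<le> 3 * real i * ln 2"
      by (intro mult_left_mono) auto
    also have "\<dots> = ln ((2 ^ i) ^ 3)"
      by (simp add: ln_realpow)
    also have "\<dots> \<le> ln (real (N i))"
    proof -
      have "((2::real) ^ i) ^ 3 * 1 \<le> (2 ^ i) ^ 3 * real (18 * i + 12)"
        by (intro mult_left_mono) auto
      then have "((2::real) ^ i) ^ 3 \<le> real (N i)"
        by (simp add: N_def)
      then show ?thesis by (intro ln_mono) auto
    qed
    finally have ln: "real i \<le> ln (real (N i))" by simp
    have "real (sensitivity (N i) (F i)) \<le> real (2 * 2 ^ i * (18 * i + 12))"
      using s[of i] by (simp only: of_nat_le_iff)
    also have "\<dots> = 2 * 2 ^ i * real (18 * i + 12)" by simp
    also have "\<dots> \<le> 2 * 2 ^ i * (30 * ln (real (N i)))"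
      using ln i by (intro mult_left_mono) auto
    finally have "real (sensitivity (N i) (F i)) ^ 3 \<le> (2 * 2 ^ i * (30 * ln (real (N i)))) ^ 3"
      by (intro power_mono) auto
    also have "\<dots> = 216000 * (2 ^ i) ^ 3 * ln (real (N i)) ^ 3"
      by (simp add: power_mult_distrib)
    finally have "1 / 216000 * real (sensitivity (N i) (F i)) ^ 3 / ln (real (N i)) ^ 3 \<le> (2 ^ i) ^ 3"
      using ln i by (simp add: field_simps)
    also have "\<dots> = real ((2 ^ i) ^ 3)" by simp
    also have "\<dots> \<le> real (query_complexity (N i) (F i))"
      using D[of i] by (simp only: of_nat_le_iff)
    finally show ?thesis using ln i by (simp add: powr_numeral)
  qed
  then have "soft_Omega N (\<lambda>i. real (query_complexity (N i) (F i)))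
      (\<lambda>i. real (sensitivity (N i) (F i)) ^ 3)"
    unfolding soft_Omega_def
    by (intro exI[of _ "1 / 216000"] exI[of _ 3] conjI eventually_sequentiallyI[of 1]) auto
  then show ?thesis using trans N_top D_top by blast
qed

end
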